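(* Let $d\in\mathbb N$, $d\ge1$, and let $m_1,\dots,m_d$ be integers $\ge2$. Set $J=[0,1]^d$ and let $g:J\to J$ be the mapping $(x_1,\dots,x_d)\mapsto(m_1x_1\pmod1,\dots,m_dx_d\pmod1)$. Then the set $$\mathcal F(J,g)=\Big\{x\in J:\lim_{n\to\infty}\frac1n\sum_{k=0}^{n-1}g^kx=x\Big\}$$ is dense in $[0,1]^d$ and of full Hausdorff dimension in $[0,1]^d$ (that is, $\dim_H\mathcal F(J,g)=d$).
   Context: $t\pmod 1$ denotes the fractional part of $t$. *)

theory Defs
  imports "HOL-Analysis.Analysis"
begin

section \<open>Hausdorff measure and Hausdorff dimension\<close>

text \<open>
  The s-th power of the diameter of a bounded set, with the usual conventions that the empty set
  contributes 0 and that, for s = 0, every nonempty set contributes 1. The case s = 0 is separate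
  because \<open>0 powr 0 = 0\<close>, whereas singletons must have zero-dimensional measure 1.
\<close>

definition diam_power :: "real \<Rightarrow> 'a::metric_space set \<Rightarrow> ennreal" where
  "diam_power s U = (if U = {} then 0 else if s = 0 then 1 else ennreal (diameter U powr s))"

text \<open>
  Boundedness of the covering sets has to be required explicitly: \<open>diameter\<close> is real-valued and
  has no meaningful value on unbounded sets.
\<close>

definition hausdorff_content :: "real \<Rightarrow> real \<Rightarrow> 'a::metric_space set \<Rightarrow> ennreal" where
  "hausdorff_content s \<delta> E =
     (INF U \<in> {U :: nat \<Rightarrow> 'a set. E \<subseteq> (\<Union>i. U i) \<and> (\<forall>i. bounded (U i) \<and> diameter (U i) \<le> \<delta>)}.
        \<Sum>i. diam_power s (U i))"

definition hausdorff_measure :: "real \<Rightarrow> 'a::metric_space set \<Rightarrow> ennreal" where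
  "hausdorff_measure s E = (SUP \<delta> \<in> {0<..}. hausdorff_content s \<delta> E)"

definition hausdorff_dim :: "'a::metric_space set \<Rightarrow> ennreal" where
  "hausdorff_dim E = Inf {ennreal s | s. 0 \<le> s \<and> hausdorff_measure s E = 0}"

section \<open>Points fixed by the ergodic averages\<close>

definition mean_fixed_points :: "'a::real_normed_vector set \<Rightarrow> ('a \<Rightarrow> 'a) \<Rightarrow> 'a set" where
  "mean_fixed_points J g =
     {x \<in> J. (\<lambda>n. (1 / real n) *\<^sub>R (\<Sum>k<n. (g ^^ k) x)) \<longlonglongrightarrow> x}"

definition mult_mod1 :: "('n \<Rightarrow> int) \<Rightarrow> real ^ 'n \<Rightarrow> real ^ 'n" where
  "mult_mod1 m x = (\<chi> i. frac (of_int (m i) * x $ i))"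

lemma mult_mod1_in_unit_cube: "mult_mod1 m x \<in> cbox 0 1"
  by (simp add: mult_mod1_def mem_box_cart frac_ge_0 less_imp_le[OF frac_lt_1])

end

theory Submission
  imports Defs "HOL-Real_Asymp.Real_Asymp"
begin

text \<open>
  The map acts on each coordinate separately as \<open>x \<mapsto> frac (b * x)\<close>, so the problem is to produce, for
  one base \<open>b \<ge> 2\<close>, many points \<open>x\<close> whose orbit average is \<open>x\<close>. Up to bounded errors the orbit sum of
  \<open>x\<close> is the sum of its base \<open>b\<close> digits divided by \<open>b - 1\<close> (\<open>digit_sum_orbit\<close>). Hence the digits
  must have average \<open>(b - 1) * x\<close>, a target determined by the same digits.

  This circular requirement is met by steering. The digits known so far determine \<open>x\<close> up to an
  exponentially small error, hence the target of their sum at time \<open>n\<close> up to a bounded one. It is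
  therefore enough to append blocks of digits of two kinds, with too few and with too many digits on
  average, according to the sign of the current surplus; the surplus then stays bounded
  (\<open>digit_sum_drift_bounded\<close>). A prefix confines \<open>x\<close> to an interval where the two kinds of block do lie
  on opposite sides of the target. Choosing a prefix near a given point proves density.

  For the dimension, almost all digits have to remain free. By the pigeonhole principle at least a fraction
  \<open>1 / (N * (b - 1) + 1)\<close> of the words of length \<open>N\<close> share one digit sum. Blocks made of an arbitrary one
  of these words, a guard digit 0 and one control digit can be steered by the control digit alone. This
  yields a map \<open>\<psi>\<close> from \<open>[0,1)\<close> into the set of mean fixed points with
  \<open>\<bar>u - v\<bar> \<le> C * \<bar>\<psi> u - \<psi> v\<bar> powr t\<close>, where \<open>t < 1\<close> is as close to 1 as desired
  (\<open>exists_expanding_parametrization\<close>). Taking such maps with the same \<open>t\<close> in all \<open>d\<close> coordinates and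
  pulling covers back to the unit cube, whose Lebesgue measure is 1, bounds the Hausdorff measure of
  dimension \<open>t * d\<close> from below (\<open>hausdorff_content_ge\<close>). The upper bound \<open>d\<close> holds for every subset of
  the unit cube, by counting the cells of a grid.
\<close>

section \<open>Digit sums and orbit sums\<close>

text \<open>
  The number of digits is a parameter because words are concatenated in blocks of fixed length, in
  which leading zeros are digits like any other.
\<close>
primrec digit_sum :: "nat \<Rightarrow> nat \<Rightarrow> nat \<Rightarrow> nat" where
  "digit_sum b 0 X = 0"
| "digit_sum b (Suc n) X = X mod b + digit_sum b n (X div b)"

lemma digit_sum_le:
  assumes "b \<ge> 1"
  shows "digit_sum b n X \<le> n * (b - 1)"
proof (induction n arbitrary: X)
  case (Suc n)
  have "X mod b \<le> b - 1" using assms by (simp add: less_eq_Suc_le[symmetric] Suc_leI less_Suc_eq_le[symmetric])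
  with Suc[of "X div b"] show ?case by simp
qed simp

lemma digit_sum_append:
  assumes "b \<ge> 1" "c < b ^ k"
  shows "digit_sum b (n + k) (X * b ^ k + c) = digit_sum b n X + digit_sum b k c"
  using assms(2)
proof (induction k arbitrary: c)
  case (Suc k)
  have e: "X * b ^ Suc k + c = c + b * (X * b ^ k)" by simp
  have "(X * b ^ Suc k + c) mod b = c mod b"
    and "(X * b ^ Suc k + c) div b = X * b ^ k + c div b"
    unfolding e using assms(1) by simp_all
  moreover have "c div b < b ^ k"
    using Suc.prems assms(1) by (simp add: less_mult_imp_div_less mult.commute)
  ultimately show ?case using Suc.IH[of "c div b"] by simp
qed simp

lemma digit_sum_zero: "digit_sum b n 0 = 0"
  by (induction n) auto

lemma digit_sum_power_minus_one:
  assumes "b \<ge> 1"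
  shows "digit_sum b n (b ^ n - 1) = n * (b - 1)"
proof (induction n)
  case (Suc n)
  obtain c where c: "b = Suc c" using assms by (cases b) auto
  define q where "q = b ^ n - 1"
  have "b ^ n = Suc q" using assms by (simp add: q_def)
  then have "b ^ Suc n - 1 = c + b * q" by (simp add: c)
  moreover have "(c + b * q) mod b = c" "(c + b * q) div b = q"
    using assms by (simp_all add: c del: mult_Suc)
  ultimately show ?case using Suc c by (simp add: q_def del: power_Suc)
qed simp

lemma floor_mult_div:
  assumes "b \<ge> 1" "y \<ge> 0"
  shows "nat \<lfloor>real b * y\<rfloor> div b = nat \<lfloor>y\<rfloor>"
proof -
  have "\<lfloor>real b * y\<rfloor> div int b = \<lfloor>real b * y / real b\<rfloor>"
    using floor_divide_real_eq_div[of "int b" "real b * y"] by simp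
  also have "\<dots> = \<lfloor>y\<rfloor>" using assms by simp
  finally show ?thesis using assms by (metis nat_div_distrib' nat_int of_nat_0_le_iff)
qed

text \<open>
  With \<open>y = b ^ k * x\<close>, the next digit of \<open>x\<close> is \<open>b * frac y - frac (b * y)\<close>; summing over
  \<open>k\<close> telescopes. Orbit averages are therefore, up to \<open>O(1/n)\<close>, digit averages divided by
  \<open>b - 1\<close>.
\<close>
lemma digit_sum_orbit:
  fixes x :: real
  assumes "b \<ge> 1" "0 \<le> x" "x < 1"
  shows "(real b - 1) * (\<Sum>k<n. frac (real b ^ k * x))
         = real (digit_sum b n (nat \<lfloor>real b ^ n * x\<rfloor>)) + frac (real b ^ n * x) - x"
proof (induction n)
  case 0
  then show ?case using assms by (simp add: frac_eq)
next
  case (Suc n)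
  define y where "y = real b ^ n * x"
  have y0: "y \<ge> 0" using assms by (simp add: y_def)
  have y': "real b ^ Suc n * x = real b * y" by (simp add: y_def)
  have fl: "nat \<lfloor>real b * y\<rfloor> div b = nat \<lfloor>y\<rfloor>" by (rule floor_mult_div[OF assms(1) y0])
  have "real (nat \<lfloor>real b * y\<rfloor>) = real (nat \<lfloor>real b * y\<rfloor> mod b) + real b * real (nat \<lfloor>y\<rfloor>)"
    using fl by (metis add.commute div_mult_mod_eq mult.commute of_nat_add of_nat_mult)
  then have "real b * frac y = frac (real b * y) + real (nat \<lfloor>real b * y\<rfloor> mod b)"
    using y0 by (simp add: frac_def algebra_simps)
  moreover have "(real b - 1) * (\<Sum>k<Suc n. frac (real b ^ k * x))
      = (real b - 1) * (\<Sum>k<n. frac (real b ^ k * x)) + real b * frac y - frac y"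
    by (simp add: y_def algebra_simps)
  moreover have "digit_sum b (Suc n) (nat \<lfloor>real b * y\<rfloor>)
      = nat \<lfloor>real b * y\<rfloor> mod b + digit_sum b n (nat \<lfloor>y\<rfloor>)"
    by (simp add: fl)
  ultimately show ?case using Suc unfolding y' y_def[symmetric] by simp
qed

text \<open>
  A strong form of being a mean fixed point in one coordinate: the orbit sums stay within a
  bounded distance of \<open>n * x\<close>. The bound \<open>x < 1\<close> makes \<open>x\<close> its own fractional part, so that the
  term \<open>k = 0\<close> is the starting point of the orbit.
\<close>
definition bounded_drift :: "nat \<Rightarrow> real \<Rightarrow> bool" where
  "bounded_drift b x \<longleftrightarrow> 0 \<le> x \<and> x < 1 \<and>
     (\<exists>C. \<forall>n. \<bar>(\<Sum>k<n. frac (real b ^ k * x)) - real n * x\<bar> \<le> C)"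

text \<open>
  The drift changes by at most 1 from one time to the next, so it is enough to control it at times
  with bounded gaps.
\<close>
lemma bounded_drift_from_progression:
  fixes x :: real
  assumes x: "0 \<le> x" "x < 1" and "L \<ge> 1"
    and C: "\<And>k. \<bar>(\<Sum>j<p + k * L. frac (real b ^ j * x)) - real (p + k * L) * x\<bar> \<le> C"
  shows "bounded_drift b x"
proof -
  define F where "F n = (\<Sum>j<n. frac (real b ^ j * x)) - real n * x" for n
  have step: "\<bar>F (n + r) - F n\<bar> \<le> real r" for n r
  proof (induction r)
    case (Suc r)
    have "F (n + Suc r) - F (n + r) = frac (real b ^ (n + r) * x) - x"
      by (simp add: F_def algebra_simps)
    then have "\<bar>F (n + Suc r) - F (n + r)\<bar> \<le> 1"
      using x frac_ge_0[of "real b ^ (n + r) * x"] frac_lt_1[of "real b ^ (n + r) * x"] by linarith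
    with Suc show ?case by simp
  qed simp
  have "\<bar>F n\<bar> \<le> C + real p + real L" for n
  proof (cases "n < p")
    case True
    have "\<bar>F n\<bar> \<le> real n" using step[of 0 n] by (simp add: F_def)
    moreover have "C \<ge> 0" using C[of 0] by linarith
    ultimately show ?thesis using True by simp
  next
    case False
    define k r where "k = (n - p) div L" and "r = (n - p) mod L"
    have n: "n = (p + k * L) + r" using False by (simp add: k_def r_def)
    have "r < L" using assms(3) by (simp add: r_def)
    moreover have "\<bar>F (p + k * L)\<bar> \<le> C" using C by (simp add: F_def)
    ultimately show ?thesis using step[of "p + k * L" r] n by simp
  qed
  then show ?thesis using x unfolding bounded_drift_def F_def by blast
qed

lemma bounded_drift_mean:
  assumes "bounded_drift b x"
  shows "(\<lambda>n. (1 / real n) * (\<Sum>k<n. frac (real b ^ k * x))) \<longlonglongrightarrow> x"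
proof -
  define F where "F n = (\<Sum>j<n. frac (real b ^ j * x)) - real n * x" for n
  obtain C where C: "\<And>n. \<bar>F n\<bar> \<le> C"
    using assms unfolding bounded_drift_def F_def by blast
  have "(\<lambda>n. F n * (1 / real n)) \<longlonglongrightarrow> 0"
    by (rule lim_null_mult_left_bounded[where B = C] ) 
       (use C lim_1_over_n in \<open>auto simp: eventually_sequentially\<close>)
  then have "(\<lambda>n. x + F n * (1 / real n)) \<longlonglongrightarrow> x + 0" by (intro tendsto_intros)
  moreover have "\<forall>\<^sub>F n in sequentially. x + F n * (1 / real n) = (1 / real n) * (\<Sum>k<n. frac (real b ^ k * x))"
    using eventually_gt_at_top[of 0] by eventually_elim (simp add: F_def field_simps)
  ultimately show ?thesis by (simp add: Lim_transform_eventually)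
qed

section \<open>Points whose digit average is steered to the point itself\<close>

text \<open>
  \<open>steer b p L P lo hi k\<close> is the integer whose base \<open>b\<close> expansion consists of a prefix \<open>P\<close> of
  length \<open>p\<close> followed by \<open>k\<close> blocks of length \<open>L\<close>. The next block is \<open>hi k\<close> or \<open>lo k\<close>. Writing
  \<open>X\<close> for the current integer and \<open>n\<close> for its length, the test compares the digit sum of \<open>X\<close> with
  \<open>(b - 1) * (X / b ^ n) * n\<close>, which is the digit sum wanted if the current approximation
  \<open>X / b ^ n\<close> were already the final point; denominators are cleared. Thus the rule steers the digit
  average towards a target that is itself only being produced. It depends on the past alone, so that
  equal words so far lead to equal choices.
\<close>
primrec steer ::
  "nat \<Rightarrow> nat \<Rightarrow> nat \<Rightarrow> nat \<Rightarrow> (nat \<Rightarrow> nat) \<Rightarrow> (nat \<Rightarrow> nat) \<Rightarrow> nat \<Rightarrow> nat" where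
  "steer b p L P lo hi 0 = P"
| "steer b p L P lo hi (Suc k) = steer b p L P lo hi k * b ^ L +
     (if digit_sum b (p + k * L) (steer b p L P lo hi k) * b ^ (p + k * L)
         \<le> (b - 1) * steer b p L P lo hi k * (p + k * L) then hi k else lo k)"

definition steered_point ::
  "nat \<Rightarrow> nat \<Rightarrow> nat \<Rightarrow> nat \<Rightarrow> (nat \<Rightarrow> nat) \<Rightarrow> (nat \<Rightarrow> nat) \<Rightarrow> real" where
  "steered_point b p L P lo hi = lim (\<lambda>k. real (steer b p L P lo hi k) / real b ^ (p + k * L))"

lemma steer_cong:
  assumes "\<And>j. j < k \<Longrightarrow> lo j = lo' j \<and> hi j = hi' j"
  shows "steer b p L P lo hi k = steer b p L P lo' hi' k"
  using assms by (induction k) auto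

text \<open>
  A block is never the word consisting of digits \<open>b - 1\<close> only, which keeps the limit point inside the
  half-open cylinders. The digit sums of the two kinds of block are constants \<open>s0\<close> and \<open>s1\<close>, and the
  prefix confines the limit point \<open>x\<close> to a cylinder on which the wanted digit sum per block,
  \<open>L * (b - 1) * x\<close>, lies between them. So a low block never raises the surplus of digits and a high
  block never lowers it.
\<close>
locale digit_steering =
  fixes b p L P :: nat and lo hi :: "nat \<Rightarrow> nat" and s0 s1 :: nat
  assumes b: "b \<ge> 2" and L: "L \<ge> 1"
    and lo: "\<And>k. lo k + 1 < b ^ L" "\<And>k. digit_sum b L (lo k) = s0"
    and hi: "\<And>k. hi k + 1 < b ^ L" "\<And>k. digit_sum b L (hi k) = s1"
    and prefix: "P < b ^ p"
      "real s0 \<le> real L * (real b - 1) * (real P / real b ^ p)"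
      "real L * (real b - 1) * ((real P + 1) / real b ^ p) \<le> real s1"
begin

abbreviation "X \<equiv> steer b p L P lo hi"
abbreviation "x \<equiv> steered_point b p L P lo hi"

text \<open>
  The cylinders \<open>[X k / b ^ n, (X k + 1) / b ^ n)\<close> are nested, and their right end points decrease
  strictly because no block is maximal.
\<close>
lemma cylinder_bounds:
  "real (X k) \<le> real b ^ (p + k * L) * x" "real b ^ (p + k * L) * x < real (X k) + 1"
proof -
  define n where "n k = p + k * L" for k
  define a c where "a k = real (X k) / real b ^ n k" and "c k = (real (X k) + 1) / real b ^ n k" for k
  have b0: "real b > 0" using b by simp
  have pw: "real b ^ n (Suc k) = real b ^ n k * real b ^ L" for k
    by (simp add: n_def power_add mult_ac)
  have lower: "X k * b ^ L \<le> X (Suc k)" for k by simp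
  have upper: "X (Suc k) + 1 < (X k + 1) * b ^ L" for k
    using lo(1)[of k] hi(1)[of k] by (simp add: algebra_simps)
  have "a k \<le> a (Suc k)" for k
  proof -
    have "real (X k) * real b ^ L \<le> real (X (Suc k))"
      using of_nat_le_iff[where 'a = real, THEN iffD2, OF lower[of k]]
      by (simp only: of_nat_mult of_nat_power)
    then show ?thesis unfolding a_def pw using b0 by (simp add: field_simps del: steer.simps)
  qed
  then have a: "incseq a" by (rule incseq_SucI)
  have c': "c (Suc k) < c k" for k
  proof -
    have "real (X (Suc k)) + 1 < (real (X k) + 1) * real b ^ L"
      using of_nat_less_iff[where 'a = real, THEN iffD2, OF upper[of k]]
      by (simp only: of_nat_add of_nat_mult of_nat_power of_nat_1)
    then have "real b ^ n k * (real (X (Suc k)) + 1) < real b ^ n k * ((real (X k) + 1) * real b ^ L)"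
      using b0 by (intro mult_strict_left_mono) auto
    then show ?thesis unfolding c_def pw using b0 by (simp add: field_simps del: steer.simps)
  qed
  then have c: "decseq c" by (intro decseq_SucI less_imp_le)
  have ac: "a j \<le> c i" for i j
  proof -
    have "a j \<le> a (max i j)" using a by (simp add: incseqD)
    also have "\<dots> \<le> c (max i j)" using b0 by (simp add: a_def c_def divide_right_mono)
    also have "\<dots> \<le> c i" using c by (simp add: decseqD)
    finally show ?thesis .
  qed
  obtain l where l: "a \<longlonglongrightarrow> l" using incseq_convergent[OF a, of "c 0"] ac by blast
  then have lx: "x = l" unfolding steered_point_def a_def n_def by (rule limI)
  have "a k \<le> x" using incseq_le[OF a l] lx by simp
  then show "real (X k) \<le> real b ^ (p + k * L) * x"
    using b0 by (simp add: a_def n_def field_simps)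
  have "x \<le> c (Suc k)" unfolding lx by (rule LIMSEQ_le_const2[OF l]) (use ac in auto)
  with c'[of k] have "x < c k" by simp
  then show "real b ^ (p + k * L) * x < real (X k) + 1"
    using b0 by (simp add: c_def n_def field_simps)
qed

lemma digit_sum_block:
  "digit_sum b (p + Suc k * L) (X (Suc k)) = digit_sum b (p + k * L) (X k) +
     (if digit_sum b (p + k * L) (X k) * b ^ (p + k * L) \<le> (b - 1) * X k * (p + k * L) then s1 else s0)"
proof -
  have e: "p + Suc k * L = (p + k * L) + L" by simp
  have "lo k < b ^ L" "hi k < b ^ L" using lo(1)[of k] hi(1)[of k] by auto
  then show ?thesis unfolding e using b
    by (simp add: digit_sum_append lo(2) hi(2))
qed

lemma in_unit_interval: "0 \<le> x" "x < 1"
  and prefix_le: "real P / real b ^ p \<le> x" and less_prefix: "x < (real P + 1) / real b ^ p"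
proof -
  have b0: "real b ^ p > 0" using b by simp
  show l: "real P / real b ^ p \<le> x" "x < (real P + 1) / real b ^ p"
    using cylinder_bounds[of 0] b0 by (simp_all add: field_simps)
  have "real P + 1 \<le> real b ^ p"
    using prefix(1) by (metis Suc_eq_plus1 Suc_leI of_nat_Suc of_nat_le_iff of_nat_power add.commute)
  then have "(real P + 1) / real b ^ p \<le> 1" using b0 by simp
  then show "x < 1" using l(2) by linarith
  show "0 \<le> x" using l(1) b0 by (meson divide_nonneg_pos of_nat_0_le_iff order_trans)
qed

lemma target_between: "real s0 \<le> real L * ((real b - 1) * x)" "real L * ((real b - 1) * x) \<le> real s1"
proof -
  have "real L * (real b - 1) \<ge> 0" using b by simp
  from mult_left_mono[OF prefix_le this] mult_left_mono[OF less_imp_le[OF less_prefix] this]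
  have "real L * (real b - 1) * (real P / real b ^ p) \<le> real L * (real b - 1) * x"
    "real L * (real b - 1) * x \<le> real L * (real b - 1) * ((real P + 1) / real b ^ p)"
    by simp_all
  then show "real s0 \<le> real L * ((real b - 1) * x)" "real L * ((real b - 1) * x) \<le> real s1"
    using prefix(2,3) by (simp_all add: mult.assoc)
qed

text \<open>
  The surplus \<open>D k\<close> is measured against the final point \<open>x\<close>, whereas the rule tests against the
  current approximation. The two targets differ by at most \<open>(b - 1) * n / b ^ n \<le> b - 1\<close>. Hence a high
  block is appended only when \<open>D k \<le> 0\<close> and a low block only when \<open>D k \<ge> - (b - 1)\<close>; each pushes
  \<open>D\<close> back in the right direction by a bounded amount.
\<close>
lemma digit_sum_drift_bounded:
  "\<exists>C. \<forall>k. \<bar>real (digit_sum b (p + k * L) (X k)) - (real b - 1) * x * real (p + k * L)\<bar> \<le> C"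
proof -
  define n where "n k = p + k * L" for k
  define t where "t = (real b - 1) * x"
  define D where "D k = real (digit_sum b (n k) (X k)) - t * real (n k)" for k
  define C where "C = max \<bar>D 0\<bar> (max (real s1) ((real b - 1) * (real L + 1)))"
  have t: "real s0 \<le> real L * t" "real L * t \<le> real s1" using target_between by (simp_all add: t_def)
  have t1: "t \<le> real b - 1"
    using in_unit_interval b unfolding t_def by (intro mult_left_le) auto
  have "\<bar>D k\<bar> \<le> C" for k
  proof (induction k)
    case 0
    then show ?case by (simp add: C_def)
  next
    case (Suc k)
    have C: "real s1 \<le> C" "(real b - 1) * (real L + 1) \<le> C" by (auto simp: C_def)
    have nS: "real (n (Suc k)) = real (n k) + real L" by (simp add: n_def)
    have B: "real b ^ n k > 0" using b by simp
    have cast: "real ((b - 1) * X k * n k) = (real b - 1) * real (X k) * real (n k)"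
      "real (digit_sum b (n k) (X k) * b ^ n k) = real (digit_sum b (n k) (X k)) * real b ^ n k"
      using b by (simp_all add: of_nat_diff)
    show ?case
    proof (cases "digit_sum b (n k) (X k) * b ^ n k \<le> (b - 1) * X k * n k")
      case True
      have "real (digit_sum b (n k) (X k)) * real b ^ n k \<le> (real b - 1) * real (X k) * real (n k)"
        using True unfolding cast[symmetric] of_nat_le_iff .
      also have "\<dots> \<le> (real b - 1) * (real b ^ n k * x) * real (n k)"
        using cylinder_bounds(1)[of k] b by (intro mult_right_mono mult_left_mono) (auto simp: n_def)
      also have "\<dots> = (t * real (n k)) * real b ^ n k" by (simp add: t_def mult_ac)
      finally have "D k \<le> 0" using B unfolding D_def by simp
      moreover have "D (Suc k) = D k + real s1 - real L * t"
      proof -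
        have "digit_sum b (n (Suc k)) (X (Suc k)) = digit_sum b (n k) (X k) + s1"
          using digit_sum_block[of k, folded n_def] True by (simp only: if_True if_False)
        then show ?thesis by (simp add: D_def nS algebra_simps del: steer.simps)
      qed
      moreover have "real L * t \<ge> 0" using t(1) by linarith
      ultimately show ?thesis using Suc t C by (simp add: abs_le_iff)
    next
      case False
      have nb: "real (n k) \<le> real b ^ n k"
      proof -
        have "n k < b ^ n k" using b by (intro power_gt_expt) simp
        then show ?thesis by (metis less_imp_le of_nat_le_iff of_nat_power)
      qed
      have "(t * real (n k) - (real b - 1)) * real b ^ n k
            \<le> (real b - 1) * (real b ^ n k * x - 1) * real (n k)"
        using mult_left_mono[OF nb, of "real b - 1"] b by (simp add: t_def algebra_simps)
      also have "\<dots> \<le> (real b - 1) * real (X k) * real (n k)"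
        using cylinder_bounds(2)[of k] b by (intro mult_right_mono mult_left_mono) (auto simp: n_def)
      also have "\<dots> \<le> real (digit_sum b (n k) (X k)) * real b ^ n k"
        using False unfolding cast[symmetric] of_nat_le_iff by simp
      finally have "D k \<ge> - (real b - 1)" using B unfolding D_def by simp
      moreover have "D (Suc k) = D k + real s0 - real L * t"
      proof -
        have "digit_sum b (n (Suc k)) (X (Suc k)) = digit_sum b (n k) (X k) + s0"
          using digit_sum_block[of k, folded n_def] False by (simp only: if_True if_False)
        then show ?thesis by (simp add: D_def nS algebra_simps del: steer.simps)
      qed
      moreover have "real L * t \<le> real L * (real b - 1)" using t1 by (intro mult_left_mono) auto
      ultimately show ?thesis using Suc t C by (simp add: abs_le_iff algebra_simps)
    qed
  qed
  then show ?thesis unfolding D_def n_def t_def by blast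
qed

lemma bounded_drift_steered_point: "bounded_drift b x"
proof -
  obtain C where C: "\<And>k. \<bar>real (digit_sum b (p + k * L) (X k)) - (real b - 1) * x * real (p + k * L)\<bar> \<le> C"
    using digit_sum_drift_bounded by blast
  show ?thesis
  proof (rule bounded_drift_from_progression[OF in_unit_interval L, where C = "C + 1"])
    fix k
    define n where "n = p + k * L"
    define F where "F = (\<Sum>j<n. frac (real b ^ j * x)) - real n * x"
    have fl: "nat \<lfloor>real b ^ n * x\<rfloor> = X k"
      using cylinder_bounds[of k] unfolding n_def by (metis floor_of_nat floor_unique nat_int of_int_of_nat_eq)
    have "(real b - 1) * F = real (digit_sum b n (X k)) - (real b - 1) * x * real n
            + (frac (real b ^ n * x) - x)"
      using digit_sum_orbit[OF _ in_unit_interval, of b n] b fl by (simp add: F_def algebra_simps)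
    moreover have "\<bar>frac (real b ^ n * x) - x\<bar> \<le> 1"
      using in_unit_interval frac_ge_0[of "real b ^ n * x"] frac_lt_1[of "real b ^ n * x"] by linarith
    ultimately have "\<bar>(real b - 1) * F\<bar> \<le> C + 1" using C[of k] unfolding n_def by linarith
    moreover have "\<bar>F\<bar> \<le> \<bar>(real b - 1) * F\<bar>"
      using b by (simp add: abs_mult mult_le_cancel_right1)
    ultimately show "\<bar>(\<Sum>j<p + k * L. frac (real b ^ j * x)) - real (p + k * L) * x\<bar> \<le> C + 1"
      unfolding F_def n_def by linarith
  qed
qed

end

text \<open>
  At the first block in which two words differ, a difference of at least 2 between the blocks cannot
  be cancelled by all later digits, which together contribute less than one unit of that block.
\<close>
lemma steered_points_separated:
  assumes st: "digit_steering b p L P lo hi s0 s1" and st': "digit_steering b p L P lo' hi' s0 s1"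
    and same: "\<And>j. j < k \<Longrightarrow> lo j = lo' j \<and> hi j = hi' j"
    and gap: "max (lo k) (hi k) + 2 \<le> min (lo' k) (hi' k)"
  shows "1 / real b ^ (p + Suc k * L) \<le> steered_point b p L P lo' hi' - steered_point b p L P lo hi"
proof -
  define n where "n = p + Suc k * L"
  have B: "real b ^ n > 0" using digit_steering.b[OF st] by simp
  have "lo k + 2 \<le> lo' k" "hi k + 2 \<le> hi' k"
    using gap max.cobounded1[of "lo k" "hi k"] max.cobounded2[of "hi k" "lo k"]
      min.cobounded1[of "lo' k" "hi' k"] min.cobounded2[of "lo' k" "hi' k"] by linarith+
  moreover have "steer b p L P lo hi k = steer b p L P lo' hi' k" by (rule steer_cong[OF same])
  ultimately have "steer b p L P lo hi (Suc k) + 2 \<le> steer b p L P lo' hi' (Suc k)"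
    by simp
  then have "real (steer b p L P lo hi (Suc k)) + 2 \<le> real (steer b p L P lo' hi' (Suc k))"
    by linarith
  moreover have "real b ^ n * steered_point b p L P lo hi < real (steer b p L P lo hi (Suc k)) + 1"
    unfolding n_def by (rule digit_steering.cylinder_bounds(2)[OF st])
  moreover have "real (steer b p L P lo' hi' (Suc k)) \<le> real b ^ n * steered_point b p L P lo' hi'"
    unfolding n_def by (rule digit_steering.cylinder_bounds(1)[OF st'])
  ultimately have "1 \<le> real b ^ n * (steered_point b p L P lo' hi' - steered_point b p L P lo hi)"
    by (simp add: right_diff_distrib del: steer.simps)
  then show ?thesis unfolding n_def[symmetric] using B by (simp add: field_simps)
qed

section \<open>Mean fixed points near every point\<close>

lemma ex_cylinder_between:
  fixes a c :: real
  assumes "b \<ge> 2" "0 \<le> a" "a < c" "c \<le> 1"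
  obtains P p :: nat where "P < b ^ p" "a \<le> real P / real b ^ p" "(real P + 1) / real b ^ p \<le> c"
proof -
  obtain p where p: "2 / (c - a) < real b ^ p" using real_arch_pow[of "real b" "2 / (c - a)"] assms by auto
  define P where "P = nat \<lceil>a * real b ^ p\<rceil>"
  have B: "real b ^ p > 0" using assms by simp
  have P: "a * real b ^ p \<le> real P" "real P < a * real b ^ p + 1"
    using assms by (simp_all add: P_def of_nat_nat) linarith+
  have "2 \<le> (c - a) * real b ^ p" using p assms by (simp add: field_simps)
  then have c: "real P + 1 \<le> c * real b ^ p" using P(2) by (simp add: algebra_simps)
  also have "\<dots> \<le> real b ^ p" using assms B by simp
  finally have "real P < real (b ^ p)" unfolding of_nat_power by linarith
  then have "P < b ^ p" by (simp only: of_nat_less_iff)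
  moreover have "a \<le> real P / real b ^ p" "(real P + 1) / real b ^ p \<le> c"
    using P c B by (simp_all add: field_simps)
  ultimately show ?thesis using that by blast
qed

text \<open>
  The blocks are \<open>0...0\<close> and \<open>(b-1)...(b-1)0\<close> of length \<open>K + 1\<close>. Their digit averages, divided by
  \<open>b - 1\<close>, are 0 and \<open>K / (K + 1)\<close>, so for large \<open>K\<close> every point of \<open>[a, c]\<close> can be a target as long
  as \<open>c < 1\<close>.
\<close>
lemma bounded_drift_dense:
  fixes y e :: real
  assumes "b \<ge> 2" "0 \<le> y" "y \<le> 1" "e > 0"
  obtains x where "bounded_drift b x" "\<bar>x - y\<bar> < e"
proof -
  define e' where "e' = min e (1 / 2)"
  define a where "a = (if y \<ge> 1 / 2 then y - e' / 2 else y)"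
  define c where "c = a + e' / 4"
  have e': "0 < e'" "e' \<le> e" "e' \<le> 1 / 2" using assms by (auto simp: e'_def)
  have ac: "0 \<le> a" "a < c" "c < 1" using assms e' by (auto simp: a_def c_def)
  obtain K where K: "1 / (1 - c) \<le> real K" using real_arch_simple by blast
  have Kc: "real (Suc K) * c \<le> real K" using K ac by (simp add: field_simps)
  obtain P p where P: "P < b ^ p" "a \<le> real P / real b ^ p" "(real P + 1) / real b ^ p \<le> c"
    using ex_cylinder_between[OF assms(1) ac(1,2)] ac(3) by (metis less_imp_le)
  have bK: "b ^ K \<ge> 1" using assms by simp
  interpret digit_steering b p "Suc K" P "\<lambda>_. 0" "\<lambda>_. b * (b ^ K - 1)" 0 "K * (b - 1)"
  proof
    show "0 + 1 < b ^ Suc K" for k :: nat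
      using one_less_power[of b "Suc K"] assms by simp
    show "b * (b ^ K - 1) + 1 < b ^ Suc K" for k :: nat
    proof -
      have "b * 1 \<le> b * b ^ K" using bK by (rule mult_left_mono) simp
      then show ?thesis using assms unfolding power_Suc right_diff_distrib' by linarith
    qed
    show "digit_sum b (Suc K) (b * (b ^ K - 1)) = K * (b - 1)" for k :: nat
      using assms digit_sum_power_minus_one[of b K] by simp
    show "real 0 \<le> real (Suc K) * (real b - 1) * (real P / real b ^ p)"
      using assms by (simp del: of_nat_Suc)
    have "real (Suc K) * (real b - 1) * ((real P + 1) / real b ^ p) \<le> real (Suc K) * (real b - 1) * c"
      using P(3) assms by (intro mult_left_mono) auto
    also have "\<dots> = (real (Suc K) * c) * (real b - 1)" by (simp add: mult_ac)
    also have "\<dots> \<le> real K * (real b - 1)"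
      using Kc assms by (intro mult_right_mono) auto
    also have "\<dots> = real (K * (b - 1))" using assms by (simp add: of_nat_diff)
    finally show "real (Suc K) * (real b - 1) * ((real P + 1) / real b ^ p) \<le> real (K * (b - 1))" .
  qed (use assms P in \<open>auto simp: digit_sum_zero\<close>)
  have "a \<le> x" "x < c" using prefix_le less_prefix P by linarith+
  then have "\<bar>x - y\<bar> < e" using e' by (auto simp: a_def c_def split: if_splits)
  then show ?thesis using bounded_drift_steered_point that by blast
qed

section \<open>An expanding parametrization of mean fixed points\<close>

text \<open>
  Pigeonhole: the \<open>b ^ N\<close> words of length \<open>N\<close> have only \<open>N * (b - 1) + 1\<close> possible digit sums, so
  some digit sum is shared by \<open>b ^ N / (N * (b - 1) + 1)\<close> of them. Compared with \<open>b ^ (t * (N + 2))\<close>,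
  the loss by a linear factor and by the two additional digits is negligible for large \<open>N\<close>.
\<close>
lemma words_with_equal_digit_sum:
  fixes t :: real
  assumes "b \<ge> 2" "0 < t" "t < 1"
  obtains N s W where "W \<subseteq> {..<b ^ N}" "\<And>w. w \<in> W \<Longrightarrow> digit_sum b N w = s"
    "(real b ^ (N + 2)) powr t \<le> real (card W)"
proof -
  define \<kappa> where "\<kappa> = (1 - t) * ln (real b)"
  have \<kappa>: "\<kappa> > 0" using assms by (simp add: \<kappa>_def)
  have "((\<lambda>N. (real N * (real b - 1) + 1) * exp (2 * t * ln (real b) - \<kappa> * real N)) \<longlongrightarrow> 0) sequentially"
    using \<kappa> by real_asymp
  then have "\<forall>\<^sub>F N in sequentially. (real N * (real b - 1) + 1) * exp (2 * t * ln (real b) - \<kappa> * real N) < 1"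
    by (rule order_tendstoD) simp
  then obtain N where N: "(real N * (real b - 1) + 1) * exp (2 * t * ln (real b) - \<kappa> * real N) < 1"
    by (auto simp: eventually_sequentially)
  define T where "T = (real b ^ (N + 2)) powr t"
  have "T = exp (2 * t * ln (real b) - \<kappa> * real N) * real b ^ N"
  proof -
    have "T = exp (t * ln (real b ^ (N + 2)))" using assms by (simp add: T_def powr_def)
    also have "ln (real b ^ (N + 2)) = real (N + 2) * ln (real b)" by (rule ln_realpow)
    also have "t * (real (N + 2) * ln (real b)) = (2 * t * ln (real b) - \<kappa> * real N) + real N * ln (real b)"
      by (simp add: \<kappa>_def algebra_simps)
    also have "exp \<dots> = exp (2 * t * ln (real b) - \<kappa> * real N) * real b ^ N"
      using assms by (simp add: exp_add exp_of_nat_mult)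
    finally show ?thesis .
  qed
  then have T: "(real N * (real b - 1) + 1) * T < real b ^ N"
    using N assms mult_strict_right_mono[OF N, of "real b ^ N"] by (simp add: mult.assoc)
  define W where "W s = {w. w < b ^ N \<and> digit_sum b N w = s}" for s
  have "\<exists>s. T \<le> real (card (W s))"
  proof (rule ccontr)
    assume "\<not> ?thesis"
    then have small: "real (card (W s)) \<le> T" for s by (meson less_imp_le not_le)
    have "{..<b ^ N} = (\<Union>s\<in>{..N * (b - 1)}. W s)"
      using digit_sum_le[of b N] assms by (auto simp: W_def)
    then have "b ^ N \<le> (\<Sum>s\<in>{..N * (b - 1)}. card (W s))"
      by (metis card_UN_le card_lessThan finite_atMost)
    then have "real (b ^ N) \<le> (\<Sum>s\<in>{..N * (b - 1)}. real (card (W s)))"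
      by (metis of_nat_le_iff of_nat_sum)
    also have "\<dots> \<le> (\<Sum>s\<in>{..N * (b - 1)}. T)" using small by (intro sum_mono)
    also have "\<dots> = (real N * (real b - 1) + 1) * T"
      using assms by (simp add: of_nat_diff algebra_simps)
    finally show False using T by simp
  qed
  then obtain s where s: "T \<le> real (card (W s))" by blast
  have "W s \<subseteq> {..<b ^ N}" by (auto simp: W_def)
  moreover have "digit_sum b N w = s" if "w \<in> W s" for w using that by (simp add: W_def)
  ultimately show ?thesis by (rule that[OF _ _ s[unfolded T_def]])
qed

definition expansion_digit :: "nat \<Rightarrow> real \<Rightarrow> nat \<Rightarrow> nat" where
  "expansion_digit M u j = nat \<lfloor>real M ^ Suc j * u\<rfloor> mod M"

lemma equal_expansion_imp_close:
  fixes u v :: real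
  assumes M: "M \<ge> 2" and uv: "0 \<le> u" "u < 1" "0 \<le> v" "v < 1"
    and eq: "\<And>j. j < k \<Longrightarrow> expansion_digit M u j = expansion_digit M v j"
  shows "\<bar>u - v\<bar> \<le> 1 / real M ^ k"
proof -
  have "nat \<lfloor>real M ^ k * u\<rfloor> = nat \<lfloor>real M ^ k * v\<rfloor>"
    using eq
  proof (induction k)
    case 0
    have "\<lfloor>u\<rfloor> = 0" "\<lfloor>v\<rfloor> = 0" using uv by (simp_all add: floor_eq_iff)
    then show ?case by simp
  next
    case (Suc k)
    have d: "nat \<lfloor>real M ^ Suc k * z\<rfloor> div M = nat \<lfloor>real M ^ k * z\<rfloor>" if "z \<ge> 0" for z
      using floor_mult_div[of M "real M ^ k * z"] M that by (simp add: mult.assoc)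
    have "nat \<lfloor>real M ^ Suc k * u\<rfloor> div M = nat \<lfloor>real M ^ Suc k * v\<rfloor> div M"
      unfolding d[OF uv(1)] d[OF uv(3)] using Suc by simp
    moreover have "nat \<lfloor>real M ^ Suc k * u\<rfloor> mod M = nat \<lfloor>real M ^ Suc k * v\<rfloor> mod M"
      using Suc.prems[of k] by (simp add: expansion_digit_def)
    ultimately show ?case by (metis div_mult_mod_eq)
  qed
  moreover have "real M ^ k * u \<ge> 0" "real M ^ k * v \<ge> 0" using uv by simp_all
  ultimately have "\<lfloor>real M ^ k * u\<rfloor> = \<lfloor>real M ^ k * v\<rfloor>" by (metis eq_nat_nat_iff zero_le_floor)
  then have "\<bar>real M ^ k * u - real M ^ k * v\<bar> \<le> 1" by linarith
  moreover have "real M ^ k * u - real M ^ k * v = real M ^ k * (u - v)" by (simp add: algebra_simps)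
  ultimately have "real M ^ k * \<bar>u - v\<bar> \<le> 1" using M by (simp add: abs_mult)
  then show ?thesis using M by (simp add: field_simps)
qed

text \<open>
  The digits of \<open>u\<close> in base \<open>M\<close> select a sequence of words from a set \<open>W\<close> of \<open>M\<close> words of length
  \<open>N\<close> with equal digit sum \<open>s\<close>. Each word is followed by a guard digit 0 and a control digit, which
  is 0 or \<open>b - 1\<close> and is left to the steering rule. If \<open>u\<close> and \<open>v\<close> first differ at position \<open>k\<close>,
  then \<open>\<bar>u - v\<bar> \<le> M powr - k\<close>, while the steered points are at least
  \<open>b powr - (p + (k + 1) * L)\<close> apart; \<open>M \<ge> b powr (t * L)\<close> then gives the estimate with exponent
  \<open>t\<close>.
\<close>
lemma exists_expanding_parametrization:
  fixes t :: real
  assumes b: "b \<ge> 2" and t: "0 < t" "t < 1"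
  obtains \<psi> :: "real \<Rightarrow> real" and C :: real where "C > 0"
    "\<And>u. 0 \<le> u \<Longrightarrow> u < 1 \<Longrightarrow> bounded_drift b (\<psi> u)"
    "\<And>u v. \<lbrakk>0 \<le> u; u < 1; 0 \<le> v; v < 1\<rbrakk> \<Longrightarrow> \<bar>u - v\<bar> \<le> C * \<bar>\<psi> u - \<psi> v\<bar> powr t"
proof -
  obtain N s W where W: "W \<subseteq> {..<b ^ N}" "\<And>w. w \<in> W \<Longrightarrow> digit_sum b N w = s"
    and cardW: "(real b ^ (N + 2)) powr t \<le> real (card W)"
    by (rule words_with_equal_digit_sum[OF b t]) blast
  define M L where "M = card W" and "L = N + 2"
  have "(real b ^ L) powr t > 1"
    using b t by (intro gr_one_powr one_less_power) (auto simp: L_def)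
  then have M: "M \<ge> 2" using cardW by (simp add: M_def L_def)
  have finW: "finite W" using W(1) finite_subset by blast
  obtain w where w: "bij_betw w {0..<M} W"
    using ex_bij_betw_nat_finite[OF finW] by (auto simp: M_def)
  define e where "e u j = w (expansion_digit M u j)" for u j
  have dM: "expansion_digit M u j < M" for u j using M by (simp add: expansion_digit_def)
  have eW: "e u j \<in> W" for u j using w dM by (auto simp: e_def bij_betw_def)
  define lo hi where "lo u j = e u j * b\<^sup>2" and "hi u j = e u j * b\<^sup>2 + (b - 1)" for u j
  \<comment> \<open>The targets for which low and high blocks are on opposite sides form the interval
    \<open>[a, c]\<close> of length \<open>1 / L\<close>.\<close>
  define a c where "a = real s / (real L * (real b - 1))" and "c = a + 1 / real L"
  have L0: "real L > 0" by (simp add: L_def)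
  have b1: "real b - 1 > 0" using b by simp
  have "W \<noteq> {}" using M by (auto simp: M_def)
  then have "s \<le> N * (b - 1)" using W(2) digit_sum_le[of b N] b by fastforce
  then have "real s \<le> real (N * (b - 1))" by (simp only: of_nat_le_iff)
  then have "real s \<le> real N * (real b - 1)" using b by (simp add: of_nat_diff)
  then have "real s / (real b - 1) \<le> real N" using b1 by (simp add: pos_divide_le_eq)
  then have "real s / (real b - 1) / real L \<le> real N / real L" using L0 by (intro divide_right_mono) auto
  then have "c \<le> (real N + 1) / real L" by (simp add: a_def c_def add_divide_distrib mult.commute)
  also have "\<dots> \<le> 1" by (simp add: L_def)
  finally have c1: "c \<le> 1" .
  have a0: "0 \<le> a" using b1 by (simp add: a_def)
  have ac: "a < c" using L0 by (simp add: c_def)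
  obtain P p where P: "P < b ^ p" "a \<le> real P / real b ^ p" "(real P + 1) / real b ^ p \<le> c"
    by (rule ex_cylinder_between[OF b a0 ac c1])
  have bb: "2 * b \<le> b\<^sup>2" using b by (simp add: power2_eq_square)
  have b2: "b - 1 < b\<^sup>2" using bb b by linarith
  have "digit_sum b (Suc (Suc 0)) (b - 1) = b - 1" using b by simp
  then have two: "digit_sum b 2 (b - 1) = b - 1" by (simp only: numeral_2_eq_2)
  have b1': "1 \<le> b" using b by simp
  have ds: "digit_sum b L (lo u j) = s" "digit_sum b L (hi u j) = s + (b - 1)" for u j
  proof -
    have "digit_sum b (N + 2) (e u j * b\<^sup>2 + 0) = digit_sum b N (e u j) + digit_sum b 2 0"
      by (rule digit_sum_append[OF b1']) (use b in simp)
    then show "digit_sum b L (lo u j) = s"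
      unfolding lo_def L_def digit_sum_zero W(2)[OF eW] add_0_right .
    have "digit_sum b (N + 2) (e u j * b\<^sup>2 + (b - 1)) = digit_sum b N (e u j) + digit_sum b 2 (b - 1)"
      by (rule digit_sum_append[OF b1' b2])
    then show "digit_sum b L (hi u j) = s + (b - 1)"
      unfolding hi_def L_def two W(2)[OF eW] .
  qed
  have bound: "hi u j + 1 < b ^ L" for u j
  proof -
    have "e u j + 1 \<le> b ^ N" using eW W(1) by (auto simp: Suc_le_eq)
    then have "(e u j + 1) * b\<^sup>2 \<le> b ^ N * b\<^sup>2" by (rule mult_right_mono) simp
    moreover have "b ^ L = b ^ N * b\<^sup>2" by (simp only: L_def power_add)
    moreover have "(e u j + 1) * b\<^sup>2 = e u j * b\<^sup>2 + b\<^sup>2" by simp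
    ultimately show ?thesis using b bb unfolding hi_def by linarith
  qed
  have steering: "digit_steering b p L P (lo u) (hi u) s (s + (b - 1))" for u
  proof
    have aL: "real L * (real b - 1) * a = real s" using L0 b1 by (simp add: a_def)
    have cL: "real L * (real b - 1) * c = real s + (real b - 1)"
      using L0 b1 by (simp add: a_def c_def field_simps)
    show "real s \<le> real L * (real b - 1) * (real P / real b ^ p)"
      unfolding aL[symmetric] using P(2) L0 b1 by (intro mult_left_mono) auto
    have "real L * (real b - 1) * ((real P + 1) / real b ^ p) \<le> real L * (real b - 1) * c"
      using P(3) L0 b1 by (intro mult_left_mono) auto
    then show "real L * (real b - 1) * ((real P + 1) / real b ^ p) \<le> real (s + (b - 1))"
      using b by (simp add: cL of_nat_diff)
    show "lo u k + 1 < b ^ L" for k using bound[of u k] by (simp add: hi_def lo_def)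
  qed (use b P bound ds in \<open>auto simp: L_def\<close>)
  define \<psi> where "\<psi> u = steered_point b p L P (lo u) (hi u)" for u
  define C where "C = (real b ^ (p + L)) powr t"
  have drift: "bounded_drift b (\<psi> u)" for u
    unfolding \<psi>_def by (rule digit_steering.bounded_drift_steered_point[OF steering])
  \<comment> \<open>The guard digit makes blocks with different words differ by at least
    \<open>b\<^sup>2 - (b - 1) \<ge> 2\<close>, whatever the control digits are.\<close>
  have sep: "1 / real b ^ (p + Suc k * L) \<le> \<psi> v - \<psi> u"
    if eq: "\<And>j. j < k \<Longrightarrow> expansion_digit M u j = expansion_digit M v j"
      and less: "e u k < e v k" for u v k
    unfolding \<psi>_def
  proof (rule steered_points_separated[OF steering steering])
    show "lo u j = lo v j \<and> hi u j = hi v j" if "j < k" for j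
      using eq[OF that] by (simp add: lo_def hi_def e_def)
    have "(e u k + 1) * b\<^sup>2 \<le> e v k * b\<^sup>2" using less by (intro mult_right_mono) auto
    moreover have "b - 1 + 2 \<le> b\<^sup>2" using b bb by linarith
    ultimately show "max (lo u k) (hi u k) + 2 \<le> min (lo v k) (hi v k)"
      by (simp add: lo_def hi_def)
  qed
  have expand: "\<bar>u - v\<bar> \<le> C * \<bar>\<psi> u - \<psi> v\<bar> powr t"
    if uv: "0 \<le> u" "u < 1" "0 \<le> v" "v < 1" for u v
  proof (cases "u = v")
    case False
    have "\<exists>j. expansion_digit M u j \<noteq> expansion_digit M v j"
    proof (rule ccontr)
      assume "\<not> ?thesis"
      then have close: "\<bar>u - v\<bar> \<le> 1 / real M ^ k" for k
        using equal_expansion_imp_close[OF M uv] by blast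
      obtain k where "1 / \<bar>u - v\<bar> < real M ^ k"
        using real_arch_pow[of "real M" "1 / \<bar>u - v\<bar>"] M by auto
      with close[of k] False M show False by (simp add: field_simps)
    qed
    then obtain k where k: "expansion_digit M u k \<noteq> expansion_digit M v k"
      and least: "\<And>j. j < k \<Longrightarrow> expansion_digit M u j = expansion_digit M v j"
      using exists_least_iff[of "\<lambda>j. expansion_digit M u j \<noteq> expansion_digit M v j"] by blast
    have "e u k \<noteq> e v k"
      using k dM w unfolding e_def bij_betw_def by (metis atLeastLessThan_iff inj_on_contraD le0)
    then have gap: "1 / real b ^ (p + Suc k * L) \<le> \<bar>\<psi> u - \<psi> v\<bar>"
      using sep[of k u v] sep[of k v u] least by (metis abs_minus_commute abs_ge_self linorder_neqE_nat order_trans)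
    have "\<bar>u - v\<bar> \<le> 1 / real M ^ k" by (rule equal_expansion_imp_close[OF M uv least])
    also have "\<dots> \<le> 1 / ((real b ^ L) powr t) ^ k"
      using cardW b M by (intro divide_left_mono power_mono) (auto simp: M_def L_def)
    also have "\<dots> = (1 / real b ^ (L * k)) powr t"
    proof -
      have "((real b ^ L) powr t) ^ k = (real b ^ (L * k)) powr t"
        using b by (induction k) (simp_all add: powr_mult power_add)
      then show ?thesis by (simp add: powr_divide)
    qed
    also have "\<dots> = (real b ^ (p + L) * (1 / real b ^ (p + Suc k * L))) powr t"
      using b by (simp add: power_add mult.commute)
    also have "\<dots> = C * (1 / real b ^ (p + Suc k * L)) powr t"
      unfolding C_def using b by (subst powr_mult) auto
    also have "\<dots> \<le> C * \<bar>\<psi> u - \<psi> v\<bar> powr t"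
    proof (intro mult_left_mono powr_mono2 gap)
      show "0 \<le> C" using b by (simp add: C_def)
    qed (use b t in auto)
    finally show ?thesis .
  qed simp
  have "C > 0" using b by (simp add: C_def)
  then show ?thesis by (rule that[OF _ drift expand])
qed

section \<open>Hausdorff measure and dimension in Euclidean space\<close>

lemma diam_power_antimono:
  assumes "s \<le> s'" "0 < s'" "bounded U" "diameter U \<le> 1"
  shows "diam_power s' U \<le> diam_power s U"
proof -
  have d: "0 \<le> diameter U" by (rule diameter_ge_0[OF assms(3)])
  have "diameter U powr s' \<le> diameter U powr s"
    using assms d by (cases "diameter U = 0") (auto intro: powr_mono')
  moreover have "diameter U powr s' \<le> 1"
    using assms d by (intro powr_le1) auto
  ultimately show ?thesis using assms by (auto simp: diam_power_def ennreal_le_iff2 simp flip: ennreal_1 intro: ennreal_leI)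
qed

lemma bounded_coordinates_emeasure:
  fixes V :: "(real ^ 'n) set"
  assumes "\<And>u v i. u \<in> V \<Longrightarrow> v \<in> V \<Longrightarrow> \<bar>u $ i - v $ i\<bar> \<le> \<rho>" "V \<noteq> {}"
  obtains Q where "V \<subseteq> Q" "Q \<in> sets lborel" "emeasure lborel Q \<le> ennreal ((2 * \<rho>) ^ CARD('n))"
proof -
  obtain u where u: "u \<in> V" using assms(2) by blast
  define Q where "Q = cbox (u - vec \<rho>) (u + vec \<rho>)"
  have "V \<subseteq> Q"
  proof
    fix v assume "v \<in> V"
    then have "\<bar>v $ i - u $ i\<bar> \<le> \<rho>" for i by (rule assms(1)[OF _ u])
    then show "v \<in> Q" by (auto simp: Q_def mem_box_cart abs_le_iff algebra_simps)
  qed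
  moreover have "measure lborel Q = (2 * \<rho>) ^ CARD('n)"
  proof -
    have "Q \<noteq> {}" using u \<open>V \<subseteq> Q\<close> by blast
    then show ?thesis by (simp add: Q_def content_cbox_cart)
  qed
  then have "emeasure lborel Q = ennreal ((2 * \<rho>) ^ CARD('n))"
    using emeasure_lborel_cbox_finite[of "u - vec \<rho>" "u + vec \<rho>"]
    by (subst emeasure_eq_ennreal_measure) (auto simp: Q_def top.not_eq_extremum)
  ultimately show ?thesis using that[of Q] by (simp add: Q_def)
qed

text \<open>
  Pulling a cover of \<open>E\<close> back along the coordinatewise map \<open>\<psi>\<close> gives a cover of the half-open unit
  cube. By the expansion hypothesis a covering set of diameter \<open>r\<close> has a preimage contained in a box
  with sides \<open>2 * K * r powr t\<close>. Since Lebesgue measure of the unit cube is 1, the volumes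
  \<open>(2 * K) ^ d * r powr (t * d)\<close>, with \<open>d\<close> the number of coordinates, add up to at least 1. The
  coordinates may have quite different scales, because only the common exponent \<open>t\<close> enters.
\<close>
lemma hausdorff_content_ge:
  fixes E :: "(real ^ 'n) set" and \<psi> :: "'n \<Rightarrow> real \<Rightarrow> real"
  assumes K: "K > 0" and t: "t > 0"
    and expand: "\<And>i u v. \<lbrakk>0 \<le> u; u < 1; 0 \<le> v; v < 1\<rbrakk> \<Longrightarrow> \<bar>u - v\<bar> \<le> K * \<bar>\<psi> i u - \<psi> i v\<bar> powr t"
    and E: "\<And>u. (\<And>i. 0 \<le> u $ i \<and> u $ i < 1) \<Longrightarrow> (\<chi> i. \<psi> i (u $ i)) \<in> E"
  shows "ennreal (1 / (2 * K) ^ CARD('n)) \<le> hausdorff_content (t * real CARD('n)) \<delta> E"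
  unfolding hausdorff_content_def
proof (rule INF_greatest)
  let ?d = "CARD('n)"
  let ?s = "t * real ?d"
  fix U :: "nat \<Rightarrow> (real ^ 'n) set"
  assume "U \<in> {U. E \<subseteq> (\<Union>i. U i) \<and> (\<forall>i. bounded (U i) \<and> diameter (U i) \<le> \<delta>)}"
  then have cover: "E \<subseteq> (\<Union>i. U i)" and bdd: "\<And>i. bounded (U i)" by auto
  define cube where "cube = {u :: real ^ 'n. \<forall>i. 0 \<le> u $ i \<and> u $ i < 1}"
  define V where "V j = {u \<in> cube. (\<chi> i. \<psi> i (u $ i)) \<in> U j}" for j
  have "\<exists>Q. V j \<subseteq> Q \<and> Q \<in> sets lborel \<and> emeasure lborel Q \<le> ennreal ((2 * K) ^ ?d) * diam_power ?s (U j)" for j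
  proof (cases "V j = {}")
    case True
    then show ?thesis by (intro exI[of _ "{}"]) auto
  next
    case False
    define r where "r = diameter (U j)"
    have r0: "r \<ge> 0" unfolding r_def by (rule diameter_ge_0[OF bdd])
    have close: "\<bar>u $ i - v $ i\<bar> \<le> K * r powr t" if uv: "u \<in> V j" "v \<in> V j" for u v i
    proof -
      have "\<bar>\<psi> i (u $ i) - \<psi> i (v $ i)\<bar> \<le> dist (\<chi> i. \<psi> i (u $ i)) (\<chi> i. \<psi> i (v $ i))"
        using component_le_norm_cart[of "(\<chi> i. \<psi> i (u $ i)) - (\<chi> i. \<psi> i (v $ i))" i]
        by (simp add: dist_norm)
      also have "\<dots> \<le> r" unfolding r_def
        by (rule diameter_bounded_bound[OF bdd]) (use uv in \<open>auto simp: V_def\<close>)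
      finally have "\<bar>\<psi> i (u $ i) - \<psi> i (v $ i)\<bar> powr t \<le> r powr t" using t by (intro powr_mono2) auto
      then have "K * \<bar>\<psi> i (u $ i) - \<psi> i (v $ i)\<bar> powr t \<le> K * r powr t" using K by simp
      moreover have "\<bar>u $ i - v $ i\<bar> \<le> K * \<bar>\<psi> i (u $ i) - \<psi> i (v $ i)\<bar> powr t"
        using uv by (intro expand) (auto simp: V_def cube_def)
      ultimately show ?thesis by linarith
    qed
    from bounded_coordinates_emeasure[OF close False]
    obtain Q where Q: "V j \<subseteq> Q" "Q \<in> sets lborel" "emeasure lborel Q \<le> ennreal ((2 * (K * r powr t)) ^ ?d)"
      by blast
    have "(r powr t) ^ ?d = r powr ?s" using r0 by (simp add: powr_realpow'[symmetric] powr_powr)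
    then have "(2 * (K * r powr t)) ^ ?d = (2 * K) ^ ?d * r powr ?s"
      by (simp add: power_mult_distrib)
    moreover have "U j \<noteq> {}" using False by (auto simp: V_def)
    ultimately have "ennreal ((2 * (K * r powr t)) ^ ?d) = ennreal ((2 * K) ^ ?d) * diam_power ?s (U j)"
      using t K by (simp add: diam_power_def ennreal_mult r_def mult.assoc)
    then show ?thesis using Q by auto
  qed
  then obtain Q where Q: "\<And>j. V j \<subseteq> Q j" "\<And>j. Q j \<in> sets lborel"
      "\<And>j. emeasure lborel (Q j) \<le> ennreal ((2 * K) ^ ?d) * diam_power ?s (U j)"
    by metis
  have "box 0 1 \<subseteq> (\<Union>j. Q j)"
  proof
    fix u :: "real ^ 'n" assume "u \<in> box 0 1"
    then have u: "u \<in> cube" by (auto simp: cube_def mem_box_cart less_imp_le)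
    then have "(\<chi> i. \<psi> i (u $ i)) \<in> E" by (intro E) (auto simp: cube_def)
    then obtain j where "(\<chi> i. \<psi> i (u $ i)) \<in> U j" using cover by auto
    then have "u \<in> V j" using u by (simp add: V_def)
    then show "u \<in> (\<Union>j. Q j)" using Q(1) by auto
  qed
  moreover have "emeasure lborel (box 0 (1 :: real ^ 'n)) = 1"
  proof -
    have "(1 :: real ^ 'n) \<bullet> v = 1" if "v \<in> Basis" for v
      using that by (auto simp: Basis_vec_def inner_axis)
    then show ?thesis by (simp add: emeasure_lborel_box_eq)
  qed
  ultimately have "1 \<le> emeasure lborel (\<Union>j. Q j)"
    using emeasure_mono[of "box 0 (1 :: real ^ 'n)" "\<Union>j. Q j" lborel] Q(2) by auto
  also have "\<dots> \<le> (\<Sum>j. emeasure lborel (Q j))"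
    using Q(2) by (intro emeasure_subadditive_countably) auto
  also have "\<dots> \<le> (\<Sum>j. ennreal ((2 * K) ^ ?d) * diam_power ?s (U j))"
    by (intro suminf_le Q(3)) auto
  also have "\<dots> = ennreal ((2 * K) ^ ?d) * (\<Sum>j. diam_power ?s (U j))" by simp
  finally have one: "1 \<le> ennreal ((2 * K) ^ ?d) * (\<Sum>j. diam_power ?s (U j))" .
  have "ennreal (1 / (2 * K) ^ ?d) = ennreal (1 / (2 * K) ^ ?d) * 1" by simp
  also have "\<dots> \<le> ennreal (1 / (2 * K) ^ ?d) * (ennreal ((2 * K) ^ ?d) * (\<Sum>j. diam_power ?s (U j)))"
    using one by (intro mult_left_mono) auto
  also have "\<dots> = (\<Sum>j. diam_power ?s (U j))"
    using K by (simp add: mult.assoc[symmetric] ennreal_mult[symmetric])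
  finally show "ennreal (1 / (2 * K) ^ ?d) \<le> (\<Sum>j. diam_power ?s (U j))" .
qed

lemma hausdorff_content_antimono:
  assumes "s \<le> s'" "0 < s'"
  shows "hausdorff_content s' 1 (E :: 'a::metric_space set) \<le> hausdorff_content s 1 E"
  unfolding hausdorff_content_def
proof (rule INF_superset_mono[OF order_refl])
  fix U :: "nat \<Rightarrow> 'a set"
  assume "U \<in> {U. E \<subseteq> (\<Union>i. U i) \<and> (\<forall>i. bounded (U i) \<and> diameter (U i) \<le> 1)}"
  then show "(\<Sum>i. diam_power s' (U i)) \<le> (\<Sum>i. diam_power s (U i))"
    using assms by (intro suminf_le diam_power_antimono) auto
qed

lemma unit_cube_grid_cover:
  fixes N :: nat
  assumes "N \<ge> 1"
  obtains U :: "nat \<Rightarrow> (real ^ 'n) set" where "cbox 0 1 \<subseteq> (\<Union>i. U i)"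
    "\<And>i. bounded (U i)" "\<And>i. diameter (U i) \<le> real CARD('n) / real N"
    "\<And>i. i \<ge> N ^ CARD('n) \<Longrightarrow> U i = {}"
proof -
  let ?I = "PiE (UNIV :: 'n set) (\<lambda>_. {..<N})"
  have "finite ?I" by (intro finite_PiE) auto
  moreover have "card ?I = N ^ CARD('n)" by (simp add: card_PiE)
  ultimately obtain h where h: "bij_betw h {0..<N ^ CARD('n)} ?I"
    using ex_bij_betw_nat_finite by metis
  define cell :: "('n \<Rightarrow> nat) \<Rightarrow> (real ^ 'n) set" where
    "cell f = cbox (\<chi> i. real (f i) / real N) (\<chi> i. (real (f i) + 1) / real N)" for f
  define U where "U j = (if j < N ^ CARD('n) then cell (h j) else {})" for j
  have N: "real N > 0" using assms by simp
  show ?thesis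
  proof
    show "cbox 0 1 \<subseteq> (\<Union>i. U i)"
    proof
      fix x :: "real ^ 'n" assume x: "x \<in> cbox 0 1"
      \<comment> \<open>The minimum puts the face \<open>x $ i = 1\<close> into the last cell.\<close>
      define f where "f i = min (N - 1) (nat \<lfloor>real N * x $ i\<rfloor>)" for i
      have x01: "0 \<le> x $ i" "x $ i \<le> 1" for i using x by (auto simp: mem_box_cart)
      have "f \<in> ?I" using assms by (auto simp: f_def)
      then have "f \<in> h ` {0..<N ^ CARD('n)}" using h by (simp only: bij_betw_def)
      then obtain j where j: "j < N ^ CARD('n)" "h j = f" by auto
      have "real (f i) \<le> real N * x $ i" "real N * x $ i \<le> real (f i) + 1" for i
      proof -
        have n: "real N * x $ i \<le> real N" "0 \<le> real N * x $ i" using x01[of i] N by (simp_all add: mult_left_le)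
        show "real (f i) \<le> real N * x $ i" using n by (simp add: f_def min_def; linarith)
        show "real N * x $ i \<le> real (f i) + 1"
          using n assms by (simp add: f_def min_def of_nat_diff; linarith)
      qed
      then have "x \<in> cell f" using N by (simp add: cell_def mem_box_cart field_simps)
      then show "x \<in> (\<Union>i. U i)" using j by (auto simp: U_def)
    qed
    show "bounded (U i)" for i by (simp add: U_def cell_def)
    show "diameter (U i) \<le> real CARD('n) / real N" for i
    proof (rule diameter_le)
      show "U i \<noteq> {} \<or> 0 \<le> real CARD('n) / real N" by simp
      fix x y assume xy: "x \<in> U i" "y \<in> U i"
      then have "\<bar>(x - y) $ l\<bar> \<le> 1 / real N" for l
      proof -
        have "x \<in> cell (h i)" "y \<in> cell (h i)" using xy by (auto simp: U_def split: if_splits)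
        then have "real (h i l) / real N \<le> x $ l" "x $ l \<le> (real (h i l) + 1) / real N"
          "real (h i l) / real N \<le> y $ l" "y $ l \<le> (real (h i l) + 1) / real N"
          by (auto simp: cell_def mem_box_cart)
        then show ?thesis by (simp add: add_divide_distrib abs_le_iff)
      qed
      then have "(\<Sum>l\<in>UNIV. \<bar>(x - y) $ l\<bar>) \<le> (\<Sum>l\<in>(UNIV :: 'n set). 1 / real N)" by (intro sum_mono)
      then show "norm (x - y) \<le> real CARD('n) / real N"
        using norm_le_l1_cart[of "x - y"] by simp
    qed
    show "U i = {}" if "i \<ge> N ^ CARD('n)" for i using that by (simp add: U_def)
  qed
qed

text \<open>
  The grid of \<open>N ^ d\<close> cubes of side \<open>1 / N\<close> has total weight at most
  \<open>N ^ d * (d / N) powr s = d powr s * N powr (d - s)\<close>, which tends to 0.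
\<close>
lemma hausdorff_measure_subset_unit_cube_eq_0:
  fixes E :: "(real ^ 'n) set"
  assumes E: "E \<subseteq> cbox 0 1" and s: "s > real CARD('n)"
  shows "hausdorff_measure s E = 0"
proof -
  let ?d = "real CARD('n)"
  have s0: "s > 0" using s by (meson le_less_trans of_nat_0_le_iff)
  have "hausdorff_content s \<delta> E \<le> 0" if \<delta>: "\<delta> > 0" for \<delta>
  proof (rule LIMSEQ_le_const)
    have "((\<lambda>N. ?d powr s * real N powr (?d - s)) \<longlongrightarrow> ?d powr s * 0) sequentially"
      using s by (intro tendsto_mult tendsto_const tendsto_neg_powr filterlim_real_sequentially) auto
    then show "(\<lambda>N. ennreal (?d powr s * real N powr (?d - s))) \<longlonglongrightarrow> 0"
      by (metis ennreal_0 mult_zero_right tendsto_ennrealI)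
    obtain N0 where N0: "?d / \<delta> \<le> real N0" using real_arch_simple by blast
    show "\<exists>N. \<forall>n\<ge>N. hausdorff_content s \<delta> E \<le> ennreal (?d powr s * real n powr (?d - s))"
    proof (intro exI allI impI)
      fix N assume N: "N \<ge> max 1 N0"
      then have N1: "N \<ge> 1" "real N > 0" by auto
      have "?d / \<delta> \<le> real N" using N0 N by linarith
      then have small: "?d / real N \<le> \<delta>" using \<delta> N1 by (simp add: field_simps)
      obtain U :: "nat \<Rightarrow> (real ^ 'n) set" where U: "cbox 0 1 \<subseteq> (\<Union>i. U i)"
        "\<And>i. bounded (U i)" "\<And>i. diameter (U i) \<le> ?d / real N"
        "\<And>i. i \<ge> N ^ CARD('n) \<Longrightarrow> U i = {}"
        using unit_cube_grid_cover[OF N1(1)] by blast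
      have "hausdorff_content s \<delta> E \<le> (\<Sum>i. diam_power s (U i))"
        unfolding hausdorff_content_def
      proof (rule INF_lower, intro CollectI conjI allI)
        show "E \<subseteq> (\<Union>i. U i)" using E U(1) by blast
        show "bounded (U i)" for i by (rule U(2))
        show "diameter (U i) \<le> \<delta>" for i using U(3)[of i] small by linarith
      qed
      also have "\<dots> = (\<Sum>i<N ^ CARD('n). diam_power s (U i))"
        by (intro suminf_finite) (auto simp: U(4) diam_power_def)
      also have "\<dots> \<le> (\<Sum>i<N ^ CARD('n). ennreal ((?d / real N) powr s))"
      proof (intro sum_mono)
        fix i
        have "diameter (U i) powr s \<le> (?d / real N) powr s"
          using U(2,3) s0 by (intro powr_mono2 diameter_ge_0) auto
        then show "diam_power s (U i) \<le> ennreal ((?d / real N) powr s)"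
          using s0 by (auto simp: diam_power_def intro: ennreal_leI)
      qed
      also have "\<dots> = ennreal (real (N ^ CARD('n)) * (?d / real N) powr s)"
        by (simp add: ennreal_mult ennreal_of_nat_eq_real_of_nat)
      also have "real (N ^ CARD('n)) * (?d / real N) powr s = ?d powr s * real N powr (?d - s)"
        using N1 by (simp add: powr_divide powr_diff powr_realpow)
      finally show "hausdorff_content s \<delta> E \<le> ennreal (?d powr s * real N powr (?d - s))" .
    qed
  qed
  then show ?thesis unfolding hausdorff_measure_def by (auto intro!: SUP_eq_const)
qed

lemma hausdorff_dim_eqI:
  fixes E :: "'a :: metric_space set"
  assumes zero: "\<And>s. s > D \<Longrightarrow> hausdorff_measure s E = 0"
    and pos: "\<And>s. 0 \<le> s \<Longrightarrow> s < D \<Longrightarrow> hausdorff_measure s E \<noteq> 0"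
    and "0 \<le> D"
  shows "hausdorff_dim E = ennreal D"
  unfolding hausdorff_dim_def
proof (rule antisym)
  show "ennreal D \<le> Inf {ennreal s | s. 0 \<le> s \<and> hausdorff_measure s E = 0}"
    using pos by (intro Inf_greatest) (force intro!: ennreal_leI simp: not_less[symmetric])
  show "Inf {ennreal s | s. 0 \<le> s \<and> hausdorff_measure s E = 0} \<le> ennreal D"
  proof (rule ennreal_le_epsilon)
    fix e :: real assume "0 < e"
    then have "hausdorff_measure (D + e) E = 0" by (intro zero) simp
    then have "Inf {ennreal s | s. 0 \<le> s \<and> hausdorff_measure s E = 0} \<le> ennreal (D + e)"
      using \<open>0 < e\<close> assms(3) by (intro Inf_lower CollectI exI[of _ "D + e"]) auto
    then show "Inf {ennreal s | s. 0 \<le> s \<and> hausdorff_measure s E = 0} \<le> ennreal D + ennreal e"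
      using \<open>0 < e\<close> assms(3) by (simp add: ennreal_plus)
  qed
qed

section \<open>Density and dimension of the set of mean fixed points\<close>

lemma frac_mult_frac: "frac (real b * frac z) = frac (real b * z)"
proof -
  have "real b * z = real b * frac z + of_int (int b * \<lfloor>z\<rfloor>)" by (simp add: frac_def algebra_simps)
  then show ?thesis by (simp only: frac_def floor_add_int[symmetric])
qed

lemma mult_mod1_iterate:
  fixes b :: "'n::finite \<Rightarrow> nat" and x :: "real ^ 'n"
  assumes "\<And>i. 0 \<le> x $ i \<and> x $ i < 1"
  shows "(mult_mod1 (\<lambda>i. int (b i)) ^^ k) x = (\<chi> i. frac (real (b i) ^ k * x $ i))"
proof (induction k)
  case 0
  show ?case using assms by (simp add: vec_eq_iff frac_eq)
next
  case (Suc k)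
  then show ?case by (simp add: mult_mod1_def frac_mult_frac mult.assoc)
qed

lemma bounded_drift_imp_mean_fixed_point:
  fixes b :: "'n::finite \<Rightarrow> nat" and x :: "real ^ 'n"
  assumes "\<And>i. bounded_drift (b i) (x $ i)"
  shows "x \<in> mean_fixed_points (cbox 0 1) (mult_mod1 (\<lambda>i. int (b i)))"
proof -
  have x: "0 \<le> x $ i \<and> x $ i < 1" for i using assms[of i] by (simp add: bounded_drift_def)
  have "(\<lambda>n. (1 / real n) *\<^sub>R (\<Sum>k<n. (mult_mod1 (\<lambda>i. int (b i)) ^^ k) x)) \<longlonglongrightarrow> x"
  proof (rule vec_tendstoI)
    fix i
    show "(\<lambda>n. ((1 / real n) *\<^sub>R (\<Sum>k<n. (mult_mod1 (\<lambda>i. int (b i)) ^^ k) x)) $ i) \<longlonglongrightarrow> x $ i"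
      using bounded_drift_mean[OF assms[of i]] by (simp add: mult_mod1_iterate[OF x])
  qed
  then show ?thesis using x by (auto simp: mean_fixed_points_def mem_box_cart less_imp_le)
qed

lemma mean_fixed_points_dense:
  fixes b :: "'n::finite \<Rightarrow> nat"
  assumes b: "\<And>i. b i \<ge> 2"
  shows "cbox 0 1 \<subseteq> closure (mean_fixed_points (cbox 0 1) (mult_mod1 (\<lambda>i. int (b i))))"
proof
  fix y :: "real ^ 'n" assume y: "y \<in> cbox 0 1"
  show "y \<in> closure (mean_fixed_points (cbox 0 1) (mult_mod1 (\<lambda>i. int (b i))))"
    unfolding closure_approachable
  proof (intro allI impI)
    fix e :: real assume e: "e > 0"
    define r where "r = e / real CARD('n)"
    have r: "r > 0" using e by (simp add: r_def)
    have "\<exists>x. bounded_drift (b i) x \<and> \<bar>x - y $ i\<bar> < r" for i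
      using bounded_drift_dense[OF b, of "y $ i" r i] y r by (auto simp: mem_box_cart)
    then obtain f where f: "\<And>i. bounded_drift (b i) (f i)" "\<And>i. \<bar>f i - y $ i\<bar> < r" by metis
    define x where "x = (\<chi> i. f i)"
    have "dist x y \<le> (\<Sum>i\<in>UNIV. \<bar>(x - y) $ i\<bar>)" unfolding dist_norm by (rule norm_le_l1_cart)
    also have "\<dots> < (\<Sum>i\<in>(UNIV :: 'n set). r)"
      using f(2) by (intro sum_strict_mono) (auto simp: x_def)
    also have "\<dots> = e" by (simp add: r_def)
    finally have "dist x y < e" .
    moreover have "x \<in> mean_fixed_points (cbox 0 1) (mult_mod1 (\<lambda>i. int (b i)))"
      by (rule bounded_drift_imp_mean_fixed_point) (simp add: x_def f(1))
    ultimately show "\<exists>x\<in>mean_fixed_points (cbox 0 1) (mult_mod1 (\<lambda>i. int (b i))). dist x y < e" by blast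
  qed
qed

text \<open>
  Any \<open>t < 1\<close> with \<open>s \<le> t * d\<close> serves as the common exponent of the expanding parametrizations of the
  coordinates. The maximum with \<open>1 / 2\<close> in the choice of \<open>t\<close> only keeps it positive when \<open>s \<le> 0\<close>.
\<close>
lemma hausdorff_measure_mean_fixed_points_pos:
  fixes b :: "'n::finite \<Rightarrow> nat"
  assumes b: "\<And>i. b i \<ge> 2" and s: "s < real CARD('n)"
  shows "hausdorff_measure s (mean_fixed_points (cbox 0 1) (mult_mod1 (\<lambda>i. int (b i)))) \<noteq> 0"
    (is "hausdorff_measure s ?F \<noteq> 0")
proof -
  let ?d = "real CARD('n)"
  define t where "t = max (s / ?d) (1 / 2)"
  have t: "0 < t" "t < 1" using s by (auto simp: t_def)
  have "s / ?d \<le> t" by (simp add: t_def)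
  then have st: "s \<le> t * ?d" by (simp add: pos_divide_le_eq)
  have "\<exists>\<psi> C. C > 0 \<and> (\<forall>u. 0 \<le> u \<longrightarrow> u < 1 \<longrightarrow> bounded_drift (b i) (\<psi> u)) \<and>
     (\<forall>u v. 0 \<le> u \<longrightarrow> u < 1 \<longrightarrow> 0 \<le> v \<longrightarrow> v < 1 \<longrightarrow> \<bar>u - v\<bar> \<le> C * \<bar>\<psi> u - \<psi> v\<bar> powr t)" for i
    by (rule exists_expanding_parametrization[OF b[of i] t]) blast
  then obtain \<psi> C where C: "\<And>i. C i > 0"
    and \<psi>: "\<And>i u. 0 \<le> u \<Longrightarrow> u < 1 \<Longrightarrow> bounded_drift (b i) (\<psi> i u)"
    and expand: "\<And>i u v. \<lbrakk>0 \<le> u; u < 1; 0 \<le> v; v < 1\<rbrakk> \<Longrightarrow> \<bar>u - v\<bar> \<le> C i * \<bar>\<psi> i u - \<psi> i v\<bar> powr t"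
    by metis
  define K where "K = (\<Sum>i\<in>UNIV. C i)"
  have CK: "C i \<le> K" for i
    unfolding K_def using C by (intro member_le_sum) (auto intro: less_imp_le)
  have K: "K > 0" unfolding K_def using C by (intro sum_pos) auto
  have "ennreal (1 / (2 * K) ^ CARD('n)) \<le> hausdorff_content (t * ?d) 1 ?F"
  proof (rule hausdorff_content_ge[OF K t(1), where \<psi> = \<psi>])
    fix i and u v :: real assume uv: "0 \<le> u" "u < 1" "0 \<le> v" "v < 1"
    have "C i * \<bar>\<psi> i u - \<psi> i v\<bar> powr t \<le> K * \<bar>\<psi> i u - \<psi> i v\<bar> powr t"
      using CK by (intro mult_right_mono) auto
    then show "\<bar>u - v\<bar> \<le> K * \<bar>\<psi> i u - \<psi> i v\<bar> powr t" using expand[OF uv, of i] by linarith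
  next
    fix u :: "real ^ 'n" assume "\<And>i. 0 \<le> u $ i \<and> u $ i < 1"
    then show "(\<chi> i. \<psi> i (u $ i)) \<in> ?F"
      by (intro bounded_drift_imp_mean_fixed_point) (simp add: \<psi>)
  qed
  also have "\<dots> \<le> hausdorff_content s 1 ?F"
    using st t by (intro hausdorff_content_antimono) auto
  also have "\<dots> \<le> hausdorff_measure s ?F"
    unfolding hausdorff_measure_def by (intro SUP_upper) auto
  finally have "ennreal (1 / (2 * K) ^ CARD('n)) \<le> hausdorff_measure s ?F" .
  moreover have "ennreal (1 / (2 * K) ^ CARD('n)) > 0"
    unfolding ennreal_less_zero_iff using K by (intro divide_pos_pos zero_less_power) auto
  ultimately have "hausdorff_measure s ?F > 0" by (rule order.strict_trans2[rotated])
  then show ?thesis by simp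
qed

theorem theorem3p5:
  fixes m :: "'n::finite \<Rightarrow> int"
  assumes "\<And>i. m i \<ge> 2"
  defines "J \<equiv> cbox (0 :: real ^ 'n) 1"
  defines "g \<equiv> mult_mod1 m"
  shows "J \<subseteq> closure (mean_fixed_points J g)
         \<and> hausdorff_dim (mean_fixed_points J g) = of_nat CARD('n)"
proof -
  define b where "b i = nat (m i)" for i
  have b: "b i \<ge> 2" for i using assms(1)[of i] by (simp add: b_def)
  have m: "m = (\<lambda>i. int (b i))"
  proof
    show "m i = int (b i)" for i using assms(1)[of i] by (simp add: b_def)
  qed
  have "hausdorff_dim (mean_fixed_points J g) = ennreal (real CARD('n))"
  proof (rule hausdorff_dim_eqI)
    show "hausdorff_measure s (mean_fixed_points J g) = 0" if "s > real CARD('n)" for s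
      using that by (intro hausdorff_measure_subset_unit_cube_eq_0) (auto simp: mean_fixed_points_def J_def)
    show "hausdorff_measure s (mean_fixed_points J g) \<noteq> 0" if "s < real CARD('n)" for s
      unfolding J_def g_def m by (rule hausdorff_measure_mean_fixed_points_pos[OF b that])
  qed simp
  then show ?thesis
    using mean_fixed_points_dense[OF b] by (simp add: J_def g_def m ennreal_of_nat_eq_real_of_nat)
qed

end
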